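(* Let $\xi$ be an $S\alpha S$ random vector in $\mathbb{R}^d$ with $\alpha\in(1,2]$, and let $K$ be its associated zonoid. If $u',u''$ are non-zero vectors in $\mathbb{R}^d$, then $$[\langle\xi,u'\rangle,\langle\xi,u''\rangle]_\alpha=h(K,u'')^{\alpha-1}\,h(T(K,u''),u').$$
   Context: A random vector $\xi\in\mathbb{R}^d$ is symmetric $\alpha$-stable ($S\alpha S$) if $\xi$ has the same distribution as $-\xi$ and $a^{1/\alpha}\xi'+b^{1/\alpha}\xi''$ has the same distribution as $(a+b)^{1/\alpha}\xi$ for all $a,b>0$, where $\xi',\xi''$ are independent copies of $\xi$. Its characteristic function is $\mathbf{E}e^{i\langle\xi,u\rangle}=\exp\{-\int_{\mathbb{S}^{d-1}}|\langle u,z\rangle|^\alpha\sigma(dz)\}$ for a symmetric finite measure $\sigma$ (the spectral measure) on the Euclidean unit sphere $\mathbb{S}^{d-1}$. The support function of a set $A$ is $h(A,u)=\sup\{\langle x,u\rangle:x\in A\}$. For $\alpha\in[1,2]$ the associated zonoid of $\xi$ is the origin-symmetric convex compact set $K$ with $h(K,u)^\alpha=\int_{\mathbb{S}^{d-1}}|\langle u,z\rangle|^\alpha\sigma(dz)$. The support set of $K$ in direction $u$ is $T(K,u)=\{y\in K:\langle y,u\rangle=h(K,u)\}$. For a pair $(\eta_1,\eta_2)$ which is an $S\alpha S$ random vector in $\mathbb{R}^2$ with $\alpha>1$ and spectral measure $\sigma'$ on $\mathbb{S}^1$, the covariation of $\eta_1$ on $\eta_2$ is $[\eta_1,\eta_2]_\alpha=\int_{\mathbb{S}^1}s_1s_2^{\langle\alpha-1\rangle}\sigma'(ds)$,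 where $t^{\langle\lambda\rangle}=|t|^\lambda\mathrm{sign}(t)$. *)

theory Defs
  imports "HOL-Probability.Probability"
begin

(* The two independent copies of \<xi> are its evaluations at the two coordinates of the
   product space M \<Otimes>\<^sub>M M. *)
definition symmetric_stable ::
  "real \<Rightarrow> 'a measure \<Rightarrow> ('a \<Rightarrow> 'v::euclidean_space) \<Rightarrow> bool" where
  "symmetric_stable \<alpha> M \<xi> \<longleftrightarrow>
     \<xi> \<in> borel_measurable M \<and>
     distr M borel \<xi> = distr M borel (\<lambda>\<omega>. - \<xi> \<omega>) \<and>
     (\<forall>a>0. \<forall>b>0.
        distr (M \<Otimes>\<^sub>M M) borel
          (\<lambda>(\<omega>', \<omega>''). a powr (1 / \<alpha>) *\<^sub>R \<xi> \<omega>' + b powr (1 / \<alpha>) *\<^sub>R \<xi> \<omega>'') =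
        distr M borel (\<lambda>\<omega>. (a + b) powr (1 / \<alpha>) *\<^sub>R \<xi> \<omega>))"

(* \<sigma> lives on the unit sphere itself: its underlying space is sphere 0 1. *)
definition spectral_measure ::
  "real \<Rightarrow> 'a measure \<Rightarrow> ('a \<Rightarrow> 'v::euclidean_space) \<Rightarrow> 'v measure \<Rightarrow> bool" where
  "spectral_measure \<alpha> M \<xi> \<sigma> \<longleftrightarrow>
     sets \<sigma> = sets (restrict_space borel (sphere 0 1)) \<and>
     finite_measure \<sigma> \<and>
     distr \<sigma> \<sigma> uminus = \<sigma> \<and>
     (\<forall>u. (CLINT \<omega>|M. iexp (\<xi> \<omega> \<bullet> u)) =
          complex_of_real (exp (- (LINT z|\<sigma>. \<bar>u \<bullet> z\<bar> powr \<alpha>))))"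

(* Real-valued, hence meaningful only for nonempty sets on which the supremum is finite. *)
definition support_function :: "'v::euclidean_space set \<Rightarrow> 'v \<Rightarrow> real" where
  "support_function A u = (SUP x\<in>A. x \<bullet> u)"

definition support_set :: "'v::euclidean_space set \<Rightarrow> 'v \<Rightarrow> 'v set" where
  "support_set K u = {y \<in> K. y \<bullet> u = support_function K u}"

(* For \<alpha> = 2 the spectral measure is not unique, but the integral below is determined by
   the law of \<xi>, so the choice of \<sigma> does not affect K. *)
definition associated_zonoid ::
  "real \<Rightarrow> 'a measure \<Rightarrow> ('a \<Rightarrow> 'v::euclidean_space) \<Rightarrow> 'v set \<Rightarrow> bool" where
  "associated_zonoid \<alpha> M \<xi> K \<longleftrightarrow>
     K \<noteq> {} \<and> convex K \<and> compact K \<and> uminus ` K = K \<and>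
     (\<exists>\<sigma>. spectral_measure \<alpha> M \<xi> \<sigma> \<and>
          (\<forall>u. support_function K u powr \<alpha> = (LINT z|\<sigma>. \<bar>u \<bullet> z\<bar> powr \<alpha>)))"

definition signed_powr :: "real \<Rightarrow> real \<Rightarrow> real" where
  "signed_powr t p = \<bar>t\<bar> powr p * sgn t"

(* The norm of real \<times> real is Euclidean, so its unit sphere is the Euclidean unit circle.
   The covariation is the common value of the integral over all spectral measures of the
   pair; only for \<alpha> = 2 can there be more than one such measure. *)
definition covariation ::
  "real \<Rightarrow> 'a measure \<Rightarrow> ('a \<Rightarrow> real) \<Rightarrow> ('a \<Rightarrow> real) \<Rightarrow> real" where
  "covariation \<alpha> M \<eta>\<^sub>1 \<eta>\<^sub>2 =
     (THE c. \<exists>\<sigma>. spectral_measure \<alpha> M (\<lambda>\<omega>. (\<eta>\<^sub>1 \<omega>, \<eta>\<^sub>2 \<omega>)) \<sigma> \<and>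
                  c = (LINT s|\<sigma>. fst s * signed_powr (snd s) (\<alpha> - 1)))"

end

theory Submission
  imports Defs
begin

text \<open>
  Both sides of the identity come from the derivative at \<open>t = 0\<close> of one function,
  \<open>F t = h(K, u'' + t u')\<^sup>\<alpha>\<close>.

  If \<open>\<tau>\<close> is any spectral measure of the pair formed by the inner products of \<open>\<xi>\<close> with \<open>u'\<close> and
  \<open>u''\<close>, then evaluating the characteristic function of \<open>\<xi>\<close> at \<open>u'' + t u'\<close> gives
  \<open>F t = \<integral> |s\<^sub>2 + t s\<^sub>1|\<^sup>\<alpha> \<tau>(ds)\<close>. Since \<open>\<alpha> > 1\<close>, one may differentiate under the integral sign
  (\<open>has_real_derivative_integral_abs_powr\<close>), so that \<open>F\<close> is differentiable at \<open>0\<close> and \<open>F'(0)\<close>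
  is \<open>\<alpha>\<close> times the covariation integral of \<open>\<tau>\<close>. As \<open>F\<close> does not mention \<open>\<tau>\<close>, this integral is
  the same for every choice of \<open>\<tau>\<close>, even for \<open>\<alpha> = 2\<close>, where \<open>\<tau>\<close> need not be unique. Such a \<open>\<tau>\<close>
  exists because a spectral measure of \<open>\<xi>\<close> induces one of every linear image of \<open>\<xi>\<close>
  (\<open>spectral_measure_linear_image\<close>); hence the covariation is well defined.

  On the geometric side, let \<open>y\<close> be a point of the support set \<open>T(K, u'')\<close> at which the linear
  functional \<open>u'\<close> is largest. As \<open>K\<close> contains \<open>y\<close> and \<open>- y\<close>, the function
  \<open>t \<mapsto> |y \<bullet> (u'' + t u')|\<^sup>\<alpha>\<close> lies below \<open>F\<close>, and the two agree at \<open>t = 0\<close>. Both are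
  differentiable there, so their derivatives coincide, and the derivative of the minorant is
  \<open>\<alpha> h(K, u'')\<^bsup>\<alpha>-1\<^esup> (y \<bullet> u')\<close>. Working with the \<open>\<alpha>\<close>-th power of \<open>h\<close> instead of \<open>h\<close> itself makes
  the argument cover the degenerate case \<open>h(K, u'') = 0\<close>, in which \<open>h\<close> need not be
  differentiable.
\<close>

section \<open>Differentiating integrals of absolute powers\<close>

lemma has_real_derivative_abs_powr:
  fixes x p :: real
  assumes "1 < p"
  shows "((\<lambda>x. \<bar>x\<bar> powr p) has_real_derivative p * signed_powr x (p - 1)) (at x)"
proof (cases x "0 :: real" rule: linorder_cases)
  case greater
  have "((\<lambda>x. x powr p) has_real_derivative p * x powr (p - 1)) (at x)"
    using greater by (rule has_real_derivative_powr)
  then have "((\<lambda>x. \<bar>x\<bar> powr p) has_real_derivative p * x powr (p - 1)) (at x)"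
    by (rule has_field_derivative_transform_within_open[of _ _ _ "{0<..}"])
       (use greater in auto)
  then show ?thesis
    using greater by (simp add: signed_powr_def)
next
  case less
  have "((\<lambda>x. (- x) powr p) has_real_derivative - (p * (- x) powr (p - 1))) (at x)"
    using less by (auto intro!: derivative_eq_intros simp: powr_diff)
  then have "((\<lambda>x. \<bar>x\<bar> powr p) has_real_derivative - (p * (- x) powr (p - 1))) (at x)"
    by (rule has_field_derivative_transform_within_open[of _ _ _ "{..<0}"])
       (use less in auto)
  then show ?thesis
    using less by (simp add: signed_powr_def)
next
  case equal
  have "((\<lambda>h. \<bar>h\<bar> powr (p - 1)) \<longlongrightarrow> \<bar>0\<bar> powr (p - 1)) (at (0 :: real))"
    using assms by (intro tendsto_powr' tendsto_intros) auto
  then have "((\<lambda>h. \<bar>h\<bar> powr p / h) \<longlongrightarrow> 0) (at (0 :: real))"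
    by (intro Lim_null_comparison[of "\<lambda>h. \<bar>h\<bar> powr p / h" "\<lambda>h. \<bar>h\<bar> powr (p - 1)"])
       (auto simp: eventually_at_filter powr_diff)
  then show ?thesis
    using equal by (simp add: signed_powr_def DERIV_def)
qed

text \<open>The Lipschitz bound from the mean value theorem; it yields a constant dominating function for
  the difference quotients in \<open>has_real_derivative_integral_abs_powr\<close>.\<close>

lemma abs_powr_diff_le:
  fixes x y p B :: real
  assumes "1 < p" "\<bar>x\<bar> \<le> B" "\<bar>y\<bar> \<le> B"
  shows "\<bar>\<bar>x\<bar> powr p - \<bar>y\<bar> powr p\<bar> \<le> p * B powr (p - 1) * \<bar>x - y\<bar>"
proof -
  have "norm (\<bar>x\<bar> powr p - \<bar>y\<bar> powr p) \<le> p * B powr (p - 1) * norm (x - y)"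
  proof (rule field_differentiable_bound[of "{-B..B}"])
    fix z assume z: "z \<in> {-B..B}"
    show "((\<lambda>x. \<bar>x\<bar> powr p) has_field_derivative p * signed_powr z (p - 1)) (at z within {-B..B})"
      by (rule has_field_derivative_at_within[OF has_real_derivative_abs_powr[OF \<open>1 < p\<close>]])
    have "\<bar>z\<bar> powr (p - 1) * \<bar>sgn z\<bar> \<le> B powr (p - 1) * 1"
      by (rule mult_mono) (use z assms in \<open>auto intro!: powr_mono2 simp: abs_sgn_eq\<close>)
    then show "norm (p * signed_powr z (p - 1)) \<le> p * B powr (p - 1)"
      using assms by (simp add: signed_powr_def abs_mult)
  qed (use assms in auto)
  then show ?thesis by simp
qed

lemma borel_measurable_signed_powr [measurable]: "(\<lambda>x. signed_powr x p) \<in> borel_measurable borel"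
proof -
  have "(\<lambda>x::real. if x = 0 then 0 else if x < 0 then - (\<bar>x\<bar> powr p) else \<bar>x\<bar> powr p)
      \<in> borel_measurable borel"
    by measurable
  then show ?thesis
    by (rule measurable_cong[THEN iffD1, rotated]) (auto simp: signed_powr_def)
qed

text \<open>Differentiation under the integral sign by dominated convergence: for \<open>|t| \<le> 1\<close> the values
  \<open>g x + t * f x\<close> stay in \<open>[-2B, 2B]\<close>, where \<open>|_|\<^sup>p\<close> is Lipschitz, and a constant is integrable
  over a finite measure.\<close>

lemma (in finite_measure) has_real_derivative_integral_abs_powr:
  fixes f g :: "'a \<Rightarrow> real"
  assumes p: "1 < p"
    and f [measurable]: "f \<in> borel_measurable M" and g [measurable]: "g \<in> borel_measurable M"
    and bounds: "\<And>x. x \<in> space M \<Longrightarrow> \<bar>f x\<bar> \<le> B" "\<And>x. x \<in> space M \<Longrightarrow> \<bar>g x\<bar> \<le> B"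
  shows "((\<lambda>t. LINT x|M. \<bar>g x + t * f x\<bar> powr p) has_real_derivative
           p * (LINT x|M. f x * signed_powr (g x) (p - 1))) (at 0)"
proof -
  have bound: "\<bar>g x + t * f x\<bar> \<le> 2 * B" if "x \<in> space M" "\<bar>t\<bar> \<le> 1" for x t
  proof -
    have "\<bar>t * f x\<bar> \<le> 1 * B"
      unfolding abs_mult by (rule mult_mono) (use bounds[OF that(1)] that in auto)
    then show ?thesis
      using bounds(2)[OF that(1)] by linarith
  qed
  have int: "integrable M (\<lambda>x. \<bar>g x + t * f x\<bar> powr p)" if "\<bar>t\<bar> \<le> 1" for t
    by (rule integrable_const_bound[of _ "(2 * B) powr p"])
       (use bound that p in \<open>auto intro!: AE_I2 powr_mono2\<close>)
  let ?q = "\<lambda>t x. (\<bar>g x + t * f x\<bar> powr p - \<bar>g x\<bar> powr p) / t"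
  let ?C = "p * (2 * B) powr (p - 1) * B"
  have lim: "((\<lambda>t. ?q t x) \<longlongrightarrow> p * (f x * signed_powr (g x) (p - 1))) (at 0)" for x
  proof -
    have "((\<lambda>t. \<bar>g x + t * f x\<bar> powr p) has_real_derivative
        p * signed_powr (g x + 0 * f x) (p - 1) * f x) (at 0)"
      by (rule DERIV_chain2[OF has_real_derivative_abs_powr[OF p]])
         (auto intro!: derivative_eq_intros)
    then show ?thesis
      by (simp add: DERIV_def algebra_simps)
  qed
  have q_bound: "\<bar>?q t x\<bar> \<le> ?C" if "x \<in> space M" "\<bar>t\<bar> \<le> 1" "t \<noteq> 0" for t x
  proof -
    have "\<bar>\<bar>g x + t * f x\<bar> powr p - \<bar>g x\<bar> powr p\<bar> \<le>
        p * (2 * B) powr (p - 1) * \<bar>g x + t * f x - g x\<bar>"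
      using bound[OF that(1,2)] bound[OF that(1), of 0] by (intro abs_powr_diff_le p) auto
    also have "\<dots> = p * (2 * B) powr (p - 1) * \<bar>f x\<bar> * \<bar>t\<bar>"
      by (simp add: abs_mult)
    also have "\<dots> \<le> ?C * \<bar>t\<bar>"
      using p bounds(1)[OF that(1)] by (intro mult_right_mono mult_left_mono) auto
    finally show ?thesis
      using that by (simp add: divide_simps)
  qed
  have "((\<lambda>t. ((LINT x|M. \<bar>g x + t * f x\<bar> powr p) - (LINT x|M. \<bar>g x\<bar> powr p)) / t)
      \<longlongrightarrow> p * (LINT x|M. f x * signed_powr (g x) (p - 1))) (at 0)"
    unfolding tendsto_at_iff_sequentially comp_def
  proof (intro allI impI)
    fix X :: "nat \<Rightarrow> real"
    assume X: "\<forall>i. X i \<in> UNIV - {0}" "X \<longlonglongrightarrow> 0"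
    have ev: "eventually (\<lambda>i. \<bar>X i\<bar> \<le> 1) sequentially"
      using tendstoD[OF X(2), of 1] by (auto elim!: eventually_mono)
    \<comment> \<open>The dominating constant is valid only for arguments in \<open>[-1, 1]\<close>, so an initial segment of
      the sequence is dropped.\<close>
    then obtain N where N: "\<And>i. i \<ge> N \<Longrightarrow> \<bar>X i\<bar> \<le> 1"
      by (auto simp: eventually_sequentially)
    let ?Y = "\<lambda>i. X (i + N)"
    have Y: "\<bar>?Y i\<bar> \<le> 1" "?Y i \<noteq> 0" for i
      using N X by auto
    have Y_lim: "filterlim ?Y (at 0) sequentially"
      using LIMSEQ_ignore_initial_segment[OF X(2), of N] Y by (auto simp: filterlim_at)
    have "(\<lambda>i. LINT x|M. ?q (?Y i) x) \<longlonglongrightarrow> (LINT x|M. p * (f x * signed_powr (g x) (p - 1)))"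
    proof (rule integral_dominated_convergence[where w = "\<lambda>_. ?C"])
      show "AE x in M. (\<lambda>i. ?q (?Y i) x) \<longlonglongrightarrow> p * (f x * signed_powr (g x) (p - 1))"
        by (intro AE_I2 filterlim_compose[OF lim Y_lim])
      show "AE x in M. norm (?q (?Y i) x) \<le> ?C" for i
        using q_bound Y by (intro AE_I2) simp
    qed auto
    moreover have "(LINT x|M. ?q (?Y i) x) =
        ((LINT x|M. \<bar>g x + ?Y i * f x\<bar> powr p) - (LINT x|M. \<bar>g x\<bar> powr p)) / ?Y i" for i
      using Bochner_Integration.integral_diff[OF int[OF Y(1)[of i]] int[of 0]] by simp
    ultimately have "(\<lambda>i. ((LINT x|M. \<bar>g x + X (i + N) * f x\<bar> powr p) -
          (LINT x|M. \<bar>g x\<bar> powr p)) / X (i + N))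
        \<longlonglongrightarrow> p * (LINT x|M. f x * signed_powr (g x) (p - 1))"
      by (simp only: integral_mult_right_zero)
    then show "(\<lambda>i. ((LINT x|M. \<bar>g x + X i * f x\<bar> powr p) - (LINT x|M. \<bar>g x\<bar> powr p)) / X i)
        \<longlonglongrightarrow> p * (LINT x|M. f x * signed_powr (g x) (p - 1))"
      by (rule LIMSEQ_offset)
  qed
  then show ?thesis
    by (simp add: DERIV_def)
qed

section \<open>Spectral measures\<close>

lemma spectral_measureD:
  assumes "spectral_measure \<alpha> M \<xi> \<sigma>"
  shows "sets \<sigma> = sets (restrict_space borel (sphere 0 1))"
    and "finite_measure \<sigma>"
    and "distr \<sigma> \<sigma> uminus = \<sigma>"
    and "(CLINT \<omega>|M. iexp (\<xi> \<omega> \<bullet> u)) =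
      complex_of_real (exp (- (LINT z|\<sigma>. \<bar>u \<bullet> z\<bar> powr \<alpha>)))"
  using assms unfolding spectral_measure_def by blast+

lemma spectral_measure_space:
  assumes "spectral_measure \<alpha> M \<xi> \<sigma>"
  shows "space \<sigma> = sphere 0 1"
  using sets_eq_imp_space_eq[OF spectral_measureD(1)[OF assms]] by (simp add: space_restrict_space)

lemma spectral_measure_borel_measurable:
  assumes "spectral_measure \<alpha> M \<xi> \<sigma>" "f \<in> borel_measurable borel"
  shows "f \<in> borel_measurable \<sigma>"
proof -
  show ?thesis
    using measurable_restrict_space1[OF assms(2)]
    by (simp only: measurable_cong_sets[OF spectral_measureD(1)[OF assms(1)] refl])
qed

text \<open>The exponents in two spectral representations of the same value of a characteristic function
  agree, since the exponents are real and \<open>exp\<close> is injective on the reals.\<close>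

lemma spectral_measure_integral_eq:
  assumes "spectral_measure \<alpha> M \<xi> \<sigma>" "spectral_measure \<beta> M \<eta> \<tau>"
    and "\<And>\<omega>. \<xi> \<omega> \<bullet> u = \<eta> \<omega> \<bullet> v"
  shows "(LINT z|\<sigma>. \<bar>u \<bullet> z\<bar> powr \<alpha>) = (LINT z|\<tau>. \<bar>v \<bullet> z\<bar> powr \<beta>)"
proof -
  have "complex_of_real (exp (- (LINT z|\<sigma>. \<bar>u \<bullet> z\<bar> powr \<alpha>))) =
      complex_of_real (exp (- (LINT z|\<tau>. \<bar>v \<bullet> z\<bar> powr \<beta>)))"
    unfolding spectral_measureD(4)[OF assms(1), symmetric]
      spectral_measureD(4)[OF assms(2), symmetric] assms(3) ..
  then show ?thesis
    by (simp only: of_real_eq_iff exp_inj_iff neg_equal_iff_equal)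
qed

text \<open>With \<open>T\<^sup>*\<close> the adjoint, the exponent of the characteristic function of \<open>T \<circ> \<xi>\<close> at \<open>u\<close> is
  \<open>\<integral> |T\<^sup>* u \<bullet> z|\<^sup>\<alpha> \<sigma>(dz) = \<integral> |T z|\<^sup>\<alpha> |u \<bullet> T z / |T z| |\<^sup>\<alpha> \<sigma>(dz)\<close>. So a spectral measure of the
  image is the measure with density \<open>|T z|\<^sup>\<alpha>\<close> with respect to \<open>\<sigma>\<close>, transported to the sphere
  by \<open>z \<mapsto> T z / |T z|\<close>.\<close>

lemma spectral_measure_linear_image:
  fixes \<xi> :: "'a \<Rightarrow> 'v::euclidean_space" and T :: "'v \<Rightarrow> 'w::euclidean_space"
  assumes spec: "spectral_measure \<alpha> M \<xi> \<sigma>" and T: "linear T" and \<alpha>: "0 < \<alpha>"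
  obtains \<tau> where "spectral_measure \<alpha> M (\<lambda>\<omega>. T (\<xi> \<omega>)) \<tau>"
proof -
  let ?S = "restrict_space borel (sphere 0 1) :: 'w measure"
  obtain e :: 'w where e: "norm e = 1"
    using vector_choose_size[of 1] by auto
  \<comment> \<open>The direction \<open>e\<close> given to points of the kernel of \<open>T\<close> is arbitrary: the weight \<open>w\<close> vanishes
    there.\<close>
  define d where "d z = (if T z = 0 then e else T z /\<^sub>R norm (T z))" for z
  define w where "w z = norm (T z) powr \<alpha>" for z
  define \<tau> where "\<tau> = distr (density \<sigma> (\<lambda>z. ennreal (w z))) ?S d"
  have sets_\<sigma>: "sets \<sigma> = sets (restrict_space borel (sphere 0 1))"
    and fin: "finite_measure \<sigma>" and sym: "distr \<sigma> \<sigma> uminus = \<sigma>"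
    using spectral_measureD[OF spec] by auto
  interpret \<sigma>: finite_measure \<sigma> by (rule fin)
  note space_\<sigma> = spectral_measure_space[OF spec]
  have T_meas [measurable]: "T \<in> borel_measurable borel"
    by (intro borel_measurable_continuous_onI linear_continuous_on)
       (simp add: T linear_conv_bounded_linear[symmetric])
  have "w \<in> borel_measurable borel" "d \<in> borel_measurable borel"
    unfolding w_def d_def by measurable
  then have w_meas [measurable]: "w \<in> borel_measurable \<sigma>" and d': "d \<in> borel_measurable \<sigma>"
    by (auto intro: spectral_measure_borel_measurable[OF spec])
  have d_meas [measurable]: "d \<in> measurable \<sigma> ?S"
    using d' by (rule measurable_restrict_space2[rotated]) (auto simp: d_def e)
  have uminus_S [measurable]: "uminus \<in> measurable ?S ?S"
    by (rule measurable_restrict_space3) auto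
  have uminus_\<sigma> [measurable]: "uminus \<in> measurable \<sigma> \<sigma>"
  proof -
    have "(uminus :: 'v \<Rightarrow> 'v) \<in> measurable (restrict_space borel (sphere 0 1))
        (restrict_space borel (sphere 0 1))"
      by (rule measurable_restrict_space3) auto
    then show ?thesis
      using measurable_cong_sets[OF sets_\<sigma> sets_\<sigma>] by simp
  qed
  obtain B where B: "\<And>z. norm (T z) \<le> B * norm z" "B > 0"
    using linear_bounded_pos[OF T] by blast
  have w_bound: "w z \<le> B powr \<alpha>" if "z \<in> space \<sigma>" for z
    using B(1)[of z] that \<alpha> unfolding w_def by (intro powr_mono2) (auto simp: space_\<sigma>)
  have emeasure_\<tau>: "emeasure \<tau> A = (\<integral>\<^sup>+z. ennreal (w z) * indicator A (d z) \<partial>\<sigma>)"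
    if [measurable]: "A \<in> sets ?S" for A
  proof -
    have "emeasure \<tau> A = emeasure (density \<sigma> (\<lambda>z. ennreal (w z))) (d -` A \<inter> space \<sigma>)"
      unfolding \<tau>_def by (subst emeasure_distr) auto
    also have "\<dots> = (\<integral>\<^sup>+z. ennreal (w z) * indicator (d -` A \<inter> space \<sigma>) z \<partial>\<sigma>)"
      by (rule emeasure_density) measurable
    also have "\<dots> = (\<integral>\<^sup>+z. ennreal (w z) * indicator A (d z) \<partial>\<sigma>)"
      by (rule nn_integral_cong) (auto simp: indicator_def)
    finally show ?thesis .
  qed
  have "finite_measure \<tau>"
  proof
    have "emeasure \<tau> (space \<tau>) \<le> (\<integral>\<^sup>+z. ennreal (B powr \<alpha>) \<partial>\<sigma>)"
    proof -
      have "emeasure \<tau> (space \<tau>) = (\<integral>\<^sup>+z. ennreal (w z) * indicator (space ?S) (d z) \<partial>\<sigma>)"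
        using emeasure_\<tau>[OF sets.top] by (simp add: \<tau>_def)
      also have "\<dots> \<le> (\<integral>\<^sup>+z. ennreal (B powr \<alpha>) \<partial>\<sigma>)"
        by (intro nn_integral_mono) (auto simp: indicator_def intro!: w_bound ennreal_leI)
      finally show ?thesis .
    qed
    also have "\<dots> < \<infinity>"
      by (simp add: ennreal_mult_less_top \<sigma>.emeasure_eq_measure)
    finally show "emeasure \<tau> (space \<tau>) \<noteq> \<infinity>" by simp
  qed
  moreover have "distr \<tau> \<tau> uminus = \<tau>"
  proof (rule measure_eqI)
    fix A assume "A \<in> sets (distr \<tau> \<tau> uminus)"
    then have A [measurable]: "A \<in> sets ?S" by (simp add: \<tau>_def)
    have [measurable]: "uminus -` A \<inter> space ?S \<in> sets ?S"
      by measurable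
    \<comment> \<open>Off the kernel of \<open>T\<close>, \<open>d\<close> is odd and \<open>w\<close> is even; on the kernel, where \<open>d\<close> is constant and
      thus not odd, both sides are zero.\<close>
    have flip: "ennreal (w (- z)) * indicator (uminus -` A \<inter> space ?S) (d (- z)) =
        ennreal (w z) * indicator A (d z)" for z
    proof (cases "T z = 0")
      case True
      then show ?thesis
        using \<alpha> by (simp add: w_def linear_neg[OF T])
    next
      case False
      then show ?thesis
        by (simp add: w_def d_def linear_neg[OF T] indicator_def space_restrict_space)
    qed
    have "emeasure (distr \<tau> \<tau> uminus) A = emeasure \<tau> (uminus -` A \<inter> space ?S)"
      by (subst emeasure_distr) (auto simp: \<tau>_def)
    also have "\<dots> = (\<integral>\<^sup>+z. ennreal (w z) * indicator (uminus -` A \<inter> space ?S) (d z) \<partial>\<sigma>)"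
      by (rule emeasure_\<tau>) measurable
    also have "\<dots> = (\<integral>\<^sup>+z. ennreal (w z) * indicator (uminus -` A \<inter> space ?S) (d z)
        \<partial>distr \<sigma> \<sigma> uminus)"
      by (simp add: sym)
    also have "\<dots> = (\<integral>\<^sup>+z. ennreal (w (- z)) *
        indicator (uminus -` A \<inter> space ?S) (d (- z)) \<partial>\<sigma>)"
      by (rule nn_integral_distr) measurable
    also have "\<dots> = emeasure \<tau> A"
      by (simp only: flip emeasure_\<tau>[OF A])
    finally show "emeasure (distr \<tau> \<tau> uminus) A = emeasure \<tau> A" .
  qed simp
  moreover have "(CLINT \<omega>|M. iexp (T (\<xi> \<omega>) \<bullet> u)) =
      complex_of_real (exp (- (LINT s|\<tau>. \<bar>u \<bullet> s\<bar> powr \<alpha>)))" for u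
  proof -
    have u_meas [measurable]: "(\<lambda>s. \<bar>u \<bullet> s\<bar> powr \<alpha>) \<in> borel_measurable ?S"
      by (rule measurable_restrict_space1) measurable
    have "(LINT s|\<tau>. \<bar>u \<bullet> s\<bar> powr \<alpha>) =
        (LINT z|density \<sigma> (\<lambda>z. ennreal (w z)). \<bar>u \<bullet> d z\<bar> powr \<alpha>)"
      unfolding \<tau>_def by (rule integral_distr) measurable
    also have "\<dots> = (LINT z|\<sigma>. w z *\<^sub>R \<bar>u \<bullet> d z\<bar> powr \<alpha>)"
    proof (rule integral_density)
      show "(\<lambda>z. \<bar>u \<bullet> d z\<bar> powr \<alpha>) \<in> borel_measurable \<sigma>"
        using measurable_compose[OF d_meas u_meas] .
    qed (use w_meas in \<open>simp_all add: w_def[abs_def]\<close>)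
    also have "\<dots> = (LINT z|\<sigma>. \<bar>adjoint T u \<bullet> z\<bar> powr \<alpha>)"
    proof (rule Bochner_Integration.integral_cong[OF refl])
      fix z
      have "\<bar>u \<bullet> T z\<bar> = norm (T z) * \<bar>u \<bullet> d z\<bar>"
        by (auto simp: d_def abs_mult)
      then show "w z *\<^sub>R \<bar>u \<bullet> d z\<bar> powr \<alpha> = \<bar>adjoint T u \<bullet> z\<bar> powr \<alpha>"
        by (simp add: adjoint_works[OF T] inner_commute w_def powr_mult)
    qed
    finally have "(LINT s|\<tau>. \<bar>u \<bullet> s\<bar> powr \<alpha>) = (LINT z|\<sigma>. \<bar>adjoint T u \<bullet> z\<bar> powr \<alpha>)" .
    then show ?thesis
      using spectral_measureD(4)[OF spec, of "adjoint T u"] by (simp only: adjoint_works[OF T])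
  qed
  moreover have "sets \<tau> = sets ?S"
    by (simp add: \<tau>_def)
  ultimately have "spectral_measure \<alpha> M (\<lambda>\<omega>. T (\<xi> \<omega>)) \<tau>"
    unfolding spectral_measure_def by blast
  then show thesis
    by (rule that)
qed

text \<open>The link between covariation and characteristic function: \<open>(t, 1) \<bullet> s = s\<^sub>2 + t s\<^sub>1\<close>, whose
  \<open>\<alpha>\<close>-th absolute power has derivative \<open>\<alpha> s\<^sub>1\<close> times the signed power of \<open>s\<^sub>2\<close> at \<open>t = 0\<close>.\<close>

lemma spectral_measure_covariation_derivative:
  fixes \<eta>\<^sub>1 \<eta>\<^sub>2 :: "'a \<Rightarrow> real"
  assumes \<alpha>: "1 < \<alpha>" and spec: "spectral_measure \<alpha> M (\<lambda>\<omega>. (\<eta>\<^sub>1 \<omega>, \<eta>\<^sub>2 \<omega>)) \<tau>"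
  shows "((\<lambda>t. LINT s|\<tau>. \<bar>(t, 1) \<bullet> s\<bar> powr \<alpha>) has_real_derivative
           \<alpha> * (LINT s|\<tau>. fst s * signed_powr (snd s) (\<alpha> - 1))) (at 0)"
proof -
  interpret finite_measure \<tau>
    by (rule spectral_measureD(2)[OF spec])
  have "\<bar>fst s\<bar> \<le> 1" "\<bar>snd s\<bar> \<le> 1" if "s \<in> space \<tau>" for s :: "real \<times> real"
    using that norm_fst_le[of "fst s" "snd s"] norm_snd_le[of "snd s" "fst s"]
    by (auto simp: spectral_measure_space[OF spec])
  then have "((\<lambda>t. LINT s|\<tau>. \<bar>snd s + t * fst s\<bar> powr \<alpha>) has_real_derivative
           \<alpha> * (LINT s|\<tau>. fst s * signed_powr (snd s) (\<alpha> - 1))) (at 0)"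
    by (intro has_real_derivative_integral_abs_powr[where B = 1] \<alpha>
        spectral_measure_borel_measurable[OF spec] borel_measurable_continuous_onI
        continuous_intros) auto
  then show ?thesis
    by (simp add: inner_prod_def add.commute)
qed

section \<open>Support functions\<close>

lemma support_set_maximiser:
  fixes K :: "'v::euclidean_space set"
  assumes K: "K \<noteq> {}" "compact K"
  obtains y where "y \<in> support_set K u" "support_function (support_set K u) v = y \<bullet> v"
proof -
  have attained: "\<exists>y\<in>A. support_function A w = y \<bullet> w" if A: "A \<noteq> {}" "compact A"
    for A :: "'v set" and w
  proof -
    obtain y where "y \<in> A" "\<forall>x\<in>A. x \<bullet> w \<le> y \<bullet> w"
      using continuous_attains_sup[OF A(2,1)
          continuous_on_inner[OF continuous_on_id continuous_on_const]] by blast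
    then show ?thesis
      by (intro bexI[of _ y]) (auto simp: support_function_def intro!: cSup_eq_maximum)
  qed
  have "support_set K u = K \<inter> {y. y \<bullet> u = support_function K u}"
    by (auto simp: support_set_def)
  moreover have "closed {y. y \<bullet> u = support_function K u}"
    by (intro closed_Collect_eq continuous_intros)
  ultimately have "compact (support_set K u)"
    using compact_Int_closed[OF K(2)] by simp
  moreover have "support_set K u \<noteq> {}"
    using attained[OF K, of u] by (auto simp: support_set_def)
  ultimately show ?thesis
    using attained that by blast
qed

lemma abs_inner_le_support_function:
  fixes K :: "'v::euclidean_space set"
  assumes K: "compact K" "uminus ` K = K" and y: "y \<in> K"
  shows "\<bar>y \<bullet> u\<bar> \<le> support_function K u"
proof -
  have "bdd_above ((\<lambda>x. x \<bullet> u) ` K)"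
    by (intro bounded_imp_bdd_above compact_imp_bounded compact_continuous_image
        continuous_intros K(1))
  then have "x \<bullet> u \<le> support_function K u" if "x \<in> K" for x
    unfolding support_function_def using that by (intro cSUP_upper)
  moreover have "- y \<in> K"
    using K(2) y by (metis imageI)
  ultimately show ?thesis
    using y by (fastforce simp: abs_le_iff)
qed

section \<open>The covariation formula\<close>

lemma has_real_derivative_eq_if_touching_below:
  fixes f g :: "real \<Rightarrow> real"
  assumes "(f has_real_derivative f') (at x)" "(g has_real_derivative g') (at x)"
    and "\<And>t. g t \<le> f t" "g x = f x"
  shows "f' = g'"
proof -
  have "((\<lambda>t. f t - g t) has_real_derivative f' - g') (at x)"
    by (intro DERIV_diff assms)
  then have "f' - g' = 0"
    by (rule DERIV_local_min[of _ _ _ 1]) (use assms in auto)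
  then show ?thesis by simp
qed

theorem theorem9p2:
  fixes M :: "'a measure"
    and \<xi> :: "'a \<Rightarrow> real ^ 'd"
    and K :: "(real ^ 'd) set"
    and u' u'' :: "real ^ 'd"
    and \<alpha> :: real
  assumes "prob_space M"
    and "1 < \<alpha>" and "\<alpha> \<le> 2"
    and "symmetric_stable \<alpha> M \<xi>"
    and "associated_zonoid \<alpha> M \<xi> K"
    and "u' \<noteq> 0" and "u'' \<noteq> 0"
  shows "covariation \<alpha> M (\<lambda>\<omega>. \<xi> \<omega> \<bullet> u') (\<lambda>\<omega>. \<xi> \<omega> \<bullet> u'') =
           support_function K u'' powr (\<alpha> - 1) * support_function (support_set K u'') u'"
proof -
  note \<alpha> = \<open>1 < \<alpha>\<close>
  from \<open>associated_zonoid \<alpha> M \<xi> K\<close> obtain \<sigma> where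
    K: "K \<noteq> {}" "compact K" "uminus ` K = K" and \<sigma>: "spectral_measure \<alpha> M \<xi> \<sigma>"
    and h: "\<And>u. support_function K u powr \<alpha> = (LINT z|\<sigma>. \<bar>u \<bullet> z\<bar> powr \<alpha>)"
    unfolding associated_zonoid_def by blast
  obtain y where y: "y \<in> support_set K u''"
    and y_max: "support_function (support_set K u'') u' = y \<bullet> u'"
    using support_set_maximiser[OF K(1,2)] .
  have yK: "y \<in> K" and y_u'': "y \<bullet> u'' = support_function K u''"
    using y by (auto simp: support_set_def)
  have h_nonneg: "0 \<le> support_function K u''"
    using abs_inner_le_support_function[OF K(2,3) yK, of u''] by linarith
  let ?\<eta> = "\<lambda>\<omega>. (\<xi> \<omega> \<bullet> u', \<xi> \<omega> \<bullet> u'')"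
  \<comment> \<open>Stated for an arbitrary \<open>\<tau>\<close>, this gives at once the uniqueness needed for the definite
    description in the covariation and its value.\<close>
  have covariation_integral: "(LINT s|\<tau>. fst s * signed_powr (snd s) (\<alpha> - 1)) =
      support_function K u'' powr (\<alpha> - 1) * (y \<bullet> u')"
    if \<tau>: "spectral_measure \<alpha> M ?\<eta> \<tau>" for \<tau>
  proof -
    have F: "(LINT s|\<tau>. \<bar>(t, 1) \<bullet> s\<bar> powr \<alpha>) = support_function K (u'' + t *\<^sub>R u') powr \<alpha>" for t
      unfolding h by (rule spectral_measure_integral_eq[OF \<tau> \<sigma>]) (simp add: inner_add_right)
    have below: "((\<lambda>t. \<bar>y \<bullet> (u'' + t *\<^sub>R u')\<bar> powr \<alpha>) has_real_derivative
        \<alpha> * signed_powr (y \<bullet> (u'' + 0 *\<^sub>R u')) (\<alpha> - 1) * (y \<bullet> u')) (at 0)"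
      by (rule DERIV_chain2[OF has_real_derivative_abs_powr[OF \<alpha>]])
         (auto simp: inner_add_right intro!: derivative_eq_intros)
    have above: "((\<lambda>t. support_function K (u'' + t *\<^sub>R u') powr \<alpha>) has_real_derivative
        \<alpha> * (LINT s|\<tau>. fst s * signed_powr (snd s) (\<alpha> - 1))) (at 0)"
      using spectral_measure_covariation_derivative[OF \<alpha> \<tau>] by (simp only: F)
    have le: "\<bar>y \<bullet> (u'' + t *\<^sub>R u')\<bar> powr \<alpha> \<le> support_function K (u'' + t *\<^sub>R u') powr \<alpha>" for t
      using \<alpha> by (intro powr_mono2 abs_inner_le_support_function K yK) auto
    have "\<alpha> * (LINT s|\<tau>. fst s * signed_powr (snd s) (\<alpha> - 1)) =
        \<alpha> * signed_powr (y \<bullet> (u'' + 0 *\<^sub>R u')) (\<alpha> - 1) * (y \<bullet> u')"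
      by (rule has_real_derivative_eq_if_touching_below[OF above _ le, unfolded mult.assoc])
         (use below y_u'' h_nonneg in \<open>simp_all add: mult.assoc\<close>)
    then show ?thesis
      using \<alpha> h_nonneg by (auto simp: y_u'' signed_powr_def sgn_if)
  qed
  have T: "linear (\<lambda>z. (z \<bullet> u', z \<bullet> u''))"
    by (rule linearI) (auto simp: inner_add_left)
  have "0 < \<alpha>"
    using \<alpha> by simp
  obtain \<tau> where \<tau>: "spectral_measure \<alpha> M ?\<eta> \<tau>"
    by (rule spectral_measure_linear_image[OF \<sigma> T \<open>0 < \<alpha>\<close>])
  show ?thesis
    unfolding covariation_def y_max
  proof (rule the_equality)
    show "\<exists>\<sigma>. spectral_measure \<alpha> M ?\<eta> \<sigma> \<and> support_function K u'' powr (\<alpha> - 1) * (y \<bullet> u') =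
        (LINT s|\<sigma>. fst s * signed_powr (snd s) (\<alpha> - 1))"
      using \<tau> covariation_integral[OF \<tau>] by auto
  qed (auto simp: covariation_integral)
qed

end
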